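(* There is no $P_2$ set that includes any positive multiple of $5$ (i.e. an element of the form $5k$ with $k$ a positive integer), and likewise there is no $P_{-3}$ set that includes any positive multiple of $5$.
   Context: Let $n$ be an integer. A set $\{a_1,a_2,\dots,a_m\}$ of $m$ different positive integers is called a $P_n$ set of size $m$ (equivalently, a Diophantine $m$-tuple with the property $D(n)$) if $a_ia_j+n$ is a perfect square (the square of an integer) for all $1\le i<j\le m$. A $P_2$ set is a $P_n$ set with $n=2$, and a $P_{-3}$ set is a $P_n$ set with $n=-3$.
   Formalization: The claim is stated for sets of size at least 2; a one-element set such as {5} satisfies the pair condition vacuously and would be both a P_2 set and a P_{-3} set containing a multiple of 5. *)

theory Defs
  imports Main
begin

(* As in the paper, the definition does not bound m from below.  For m \<le> 1 the
   condition on pairs is vacuous, so every singleton of a positive integer is a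
   P_n set of size 1; statements about P_n sets have to exclude this case. *)
definition P_set :: "int \<Rightarrow> nat \<Rightarrow> int set \<Rightarrow> bool" where
  "P_set n m A \<longleftrightarrow>
     finite A \<and> card A = m \<and> (\<forall>a\<in>A. a > 0) \<and>
     (\<forall>a\<in>A. \<forall>b\<in>A. a \<noteq> b \<longrightarrow> (\<exists>x::int. a * b + n = x\<^sup>2))"

end

theory Submission
  imports Defs
begin

text \<open>
  Modulo \<open>5\<close> the squares are \<open>0\<close>, \<open>1\<close> and \<open>4\<close>. If \<open>5 * k\<close> and \<open>b\<close> are distinct
  members of a \<open>P_n\<close> set, then \<open>5 * k * b + n\<close> is a square congruent to \<open>n\<close>, so \<open>n\<close> is a
  square modulo \<open>5\<close>. Both \<open>2\<close> and \<open>- 3\<close> lie in the residue class of \<open>2\<close>, which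
  contains no square.
\<close>

lemma square_mod_5_neq_2: "(x::int)\<^sup>2 mod 5 \<noteq> 2"
proof -
  have "x mod 5 \<in> {0, 1, 2, 3, 4}" by auto
  then have "(x mod 5)\<^sup>2 mod 5 \<noteq> 2" by auto
  then show ?thesis by (simp add: power_mod)
qed

lemma P_set_no_multiple_of_5:
  assumes n: "n mod 5 = 2" and m: "m \<ge> 2" and P: "P_set n m A"
  shows "5 * k \<notin> A"
proof
  assume kA: "5 * k \<in> A"
  have "finite A" "card A \<ge> 2" using P m by (auto simp: P_set_def)
  then have "\<not> A \<subseteq> {5 * k}" using card_mono[of "{5 * k}" A] by auto
  then obtain b where "b \<in> A" "b \<noteq> 5 * k" by blast
  with kA P obtain x where x: "5 * k * b + n = x\<^sup>2"
    unfolding P_set_def by metis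
  have "(5 * k * b + n) mod 5 = 2" using n by (simp add: mult.assoc)
  with x square_mod_5_neq_2 show False by simp
qed

theorem mainTheorem8:
  shows "\<not> (\<exists>(m::nat) (A::int set) (k::int). m \<ge> 2 \<and> P_set 2 m A \<and> k > 0 \<and> 5 * k \<in> A) \<and>
         \<not> (\<exists>(m::nat) (A::int set) (k::int). m \<ge> 2 \<and> P_set (- 3) m A \<and> k > 0 \<and> 5 * k \<in> A)"
  using P_set_no_multiple_of_5[of 2] P_set_no_multiple_of_5[of "- 3"] by auto

end
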